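(* Let $n \ge 0$ be an integer, $d := 2^n$, and $\boldsymbol{b}, \boldsymbol{c} \in \mathbb{R}^{2d}$. Then $$\mathcal{P}_{n+1}(\boldsymbol{b},\boldsymbol{c}) = \left\{ (\boldsymbol{k}_1;\boldsymbol{k}_2) \in \mathbb{R}^{2d} \;\middle|\; \boldsymbol{k}_1 \in \mathcal{P}_n\big(\rho_n(\boldsymbol{b}), \rho_n(\boldsymbol{c})\big),\ \boldsymbol{k}_2 \in \mathcal{P}_n\big(\phi_n(A_n\boldsymbol{k}_1,\boldsymbol{b},\boldsymbol{c}),\ \psi_n(A_n\boldsymbol{k}_1,\boldsymbol{b},\boldsymbol{c})\big) \right\}.$$
   Context: For vectors $\boldsymbol{u},\boldsymbol{v}$ of the same dimension, $\boldsymbol{u}\le\boldsymbol{v}$ means componentwise inequality, and $\max(\boldsymbol{u},\boldsymbol{v})$, $\min(\boldsymbol{u},\boldsymbol{v})$ are taken componentwise. $(\boldsymbol{x}_1;\boldsymbol{x}_2)$ denotes vertical concatenation of column vectors. For each integer $n\ge 0$ put $d=2^n$. Define integers $\sigma(n,k)$, $1\le k\le 2^n$, recursively by $\sigma(0,1)=1$ and, with $d=2^n$, $\sigma(n+1,k)=\sigma(n,k)$ if $1\le k\le d$, $\sigma(n+1,k)=2d+1-\sigma(n,k-d)$ if $d+1\le k\le 2d$. Define $\xi_{n,k}=2\cos\left(\frac{\pi(2\sigma(n,k)-1)}{2\cdot 2^n}\right)$ for $1\le k\le 2^n$. Let $D_n=\operatorname{diag}(\xi_{n+1,1},\dots,\xi_{n+1,2^n})\in\mathbb{R}^{2^n\times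 2^n}$. Define matrices $A_n\in\mathbb{R}^{2^n\times 2^n}$ recursively by $A_0=1$ and $$A_{n+1}=\begin{pmatrix}A_n & D_nA_n\\ A_n & -D_nA_n\end{pmatrix}.$$ For $\boldsymbol{a}_1\in\mathbb{R}^{d}$ and $\boldsymbol{b}=(\boldsymbol{b}_1;\boldsymbol{b}_2),\ \boldsymbol{c}=(\boldsymbol{c}_1;\boldsymbol{c}_2)\in\mathbb{R}^{2d}$ with $\boldsymbol{b}_i,\boldsymbol{c}_i\in\mathbb{R}^d$, $d=2^n$, define $\rho_n(\boldsymbol{b})=(\boldsymbol{b}_1+\boldsymbol{b}_2)/2$, $\phi_n(\boldsymbol{a}_1,\boldsymbol{b},\boldsymbol{c})=D_n^{-1}\max(\boldsymbol{b}_1-\boldsymbol{a}_1,\,-\boldsymbol{c}_2+\boldsymbol{a}_1)$, $\psi_n(\boldsymbol{a}_1,\boldsymbol{b},\boldsymbol{c})=D_n^{-1}\min(\boldsymbol{c}_1-\boldsymbol{a}_1,\,-\boldsymbol{b}_2+\boldsymbol{a}_1)$, all in $\mathbb{R}^d$. For $\boldsymbol{b},\boldsymbol{c}\in\mathbb{R}^{2^n}$ define $\mathcal{P}_n(\boldsymbol{b},\boldsymbol{c})=\{\boldsymbol{k}\in\mathbb{Z}^{2^n}\mid \boldsymbol{b}\le A_n\boldsymbol{k}\le\boldsymbol{c}\}$. *)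

theory Defs
  imports Complex_Main "Jordan_Normal_Form.Gauss_Jordan_Elimination"
begin

text \<open>Only the values at \<^term>\<open>1 \<le> k \<and> k \<le> 2 ^ n\<close> are meaningful.\<close>

fun sigma :: "nat \<Rightarrow> nat \<Rightarrow> int" where
  "sigma 0 k = 1"
| "sigma (Suc n) k =
     (if k \<le> 2 ^ n then sigma n k else 2 * 2 ^ n + 1 - sigma n (k - 2 ^ n))"

definition xi :: "nat \<Rightarrow> nat \<Rightarrow> real" where
  "xi n k = 2 * cos (pi * (2 * real_of_int (sigma n k) - 1) / (2 * 2 ^ n))"

text \<open>Matrix indices start at \<open>0\<close>, whereas the second index of \<^const>\<open>xi\<close> starts at \<open>1\<close>.\<close>

definition D_mat :: "nat \<Rightarrow> real mat" where
  "D_mat n = mat_diag (2 ^ n) (\<lambda>i. xi (n + 1) (i + 1))"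

fun A_mat :: "nat \<Rightarrow> real mat" where
  "A_mat 0 = 1\<^sub>m 1"
| "A_mat (Suc n) =
     four_block_mat (A_mat n) (D_mat n * A_mat n) (A_mat n) (- D_mat n * A_mat n)"

text \<open>\<^const>\<open>mat_inverse\<close> is partial; lemma \<open>D_inv\<close> below shows that it is defined here.\<close>

definition D_inv :: "nat \<Rightarrow> real mat" where
  "D_inv n = the (mat_inverse (D_mat n))"

definition vec_max :: "real vec \<Rightarrow> real vec \<Rightarrow> real vec" where
  "vec_max u v = vec (dim_vec v) (\<lambda>i. max (u $ i) (v $ i))"

definition vec_min :: "real vec \<Rightarrow> real vec \<Rightarrow> real vec" where
  "vec_min u v = vec (dim_vec v) (\<lambda>i. min (u $ i) (v $ i))"

text \<open>For \<open>b\<close> of dimension \<^term>\<open>2 * 2 ^ n\<close>, \<open>vec_first b (2 ^ n)\<close> and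
  \<open>vec_last b (2 ^ n)\<close> are its upper and lower halves.\<close>

definition rho :: "nat \<Rightarrow> real vec \<Rightarrow> real vec" where
  "rho n b = (1 / 2) \<cdot>\<^sub>v (vec_first b (2 ^ n) + vec_last b (2 ^ n))"

definition phi :: "nat \<Rightarrow> real vec \<Rightarrow> real vec \<Rightarrow> real vec \<Rightarrow> real vec" where
  "phi n a1 b c =
     D_inv n *\<^sub>v vec_max (vec_first b (2 ^ n) - a1) (- vec_last c (2 ^ n) + a1)"

definition psi :: "nat \<Rightarrow> real vec \<Rightarrow> real vec \<Rightarrow> real vec \<Rightarrow> real vec" where
  "psi n a1 b c =
     D_inv n *\<^sub>v vec_min (vec_first c (2 ^ n) - a1) (- vec_last b (2 ^ n) + a1)"

text \<open>Integer vectors are represented as real vectors with entries in \<open>\<int>\<close>; the order on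
  vectors is the componentwise one.\<close>

definition P_set :: "nat \<Rightarrow> real vec \<Rightarrow> real vec \<Rightarrow> real vec set" where
  "P_set n b c =
     {k \<in> carrier_vec (2 ^ n).
        (\<forall>i < 2 ^ n. k $ i \<in> \<int>) \<and> b \<le> A_mat n *\<^sub>v k \<and> A_mat n *\<^sub>v k \<le> c}"

lemma sigma_bounds:
  assumes "1 \<le> k" "k \<le> 2 ^ n"
  shows "1 \<le> sigma n k \<and> sigma n k \<le> 2 ^ n"
  using assms
proof (induction n arbitrary: k)
  case (Suc n)
  show ?case
  proof (cases "k \<le> 2 ^ n")
    case True
    have "(0::int) \<le> 2 ^ n" by simp
    moreover have "sigma (Suc n) k = sigma n k" "(2::int) ^ Suc n = 2 * 2 ^ n"
      using True by simp_all
    ultimately show ?thesis using Suc.IH[of k] Suc.prems True by linarith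
  next
    case False
    then have "1 \<le> k - 2 ^ n" "k - 2 ^ n \<le> 2 ^ n" using Suc.prems by auto
    then have "1 \<le> sigma n (k - 2 ^ n) \<and> sigma n (k - 2 ^ n) \<le> 2 ^ n" by (rule Suc.IH)
    moreover have "sigma (Suc n) k = 2 * 2 ^ n + 1 - sigma n (k - 2 ^ n)"
      "(2::int) ^ Suc n = 2 * 2 ^ n" using False by simp_all
    ultimately show ?thesis by linarith
  qed
qed auto

lemma xi_pos:
  assumes "i < 2 ^ n"
  shows "0 < xi (n + 1) (i + 1)"
proof -
  let ?s = "real_of_int (sigma n (i + 1))"
  have "1 \<le> sigma n (i + 1) \<and> sigma n (i + 1) \<le> 2 ^ n"
    using sigma_bounds[of "i + 1" n] assms by simp
  then have s: "1 \<le> ?s" "?s \<le> 2 ^ n"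
    using of_int_le_iff[where 'a = real, of "sigma n (i + 1)" "2 ^ n"] by simp_all
  then have "2 * ?s - 1 < 2 * 2 ^ n" by linarith
  then have "pi * (2 * ?s - 1) < pi * (2 * 2 ^ n)" by (rule mult_strict_left_mono) simp
  then have "pi * (2 * ?s - 1) / (2 * 2 ^ (n + 1)) < pi / 2" by (simp add: field_simps)
  moreover have "0 < pi * (2 * ?s - 1) / (2 * 2 ^ (n + 1))" using s by simp
  ultimately have "0 < cos (pi * (2 * ?s - 1) / (2 * 2 ^ (n + 1)))" by (intro cos_gt_zero)
  moreover have "sigma (n + 1) (i + 1) = sigma n (i + 1)" using assms by simp
  ultimately show ?thesis unfolding xi_def by simp
qed

lemma D_inv:
  "mat_inverse (D_mat n) = Some (D_inv n)"
  "D_inv n \<in> carrier_mat (2 ^ n) (2 ^ n)"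
  "D_mat n * D_inv n = 1\<^sub>m (2 ^ n)"
  "D_inv n * D_mat n = 1\<^sub>m (2 ^ n)"
proof -
  let ?E = "mat_diag (2 ^ n) (\<lambda>i. 1 / xi (n + 1) (i + 1))"
  have D: "D_mat n \<in> carrier_mat (2 ^ n) (2 ^ n)" by (simp add: D_mat_def)
  have "D_mat n * ?E = 1\<^sub>m (2 ^ n)" "?E * D_mat n = 1\<^sub>m (2 ^ n)"
    unfolding D_mat_def mat_diag_diag
    by (rule eq_matI; use xi_pos[of _ n] in \<open>force simp: mat_diag_def\<close>)+
  then have "D_mat n \<in> Units (ring_mat TYPE(real) (2 ^ n) ())"
    using D unfolding Units_def ring_mat_def by (auto intro!: bexI[of _ ?E])
  then have "mat_inverse (D_mat n) \<noteq> None" using mat_inverse(1)[OF D, of "()"] by blast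
  then show *: "mat_inverse (D_mat n) = Some (D_inv n)" by (simp add: D_inv_def)
  show "D_inv n \<in> carrier_mat (2 ^ n) (2 ^ n)" "D_mat n * D_inv n = 1\<^sub>m (2 ^ n)"
    "D_inv n * D_mat n = 1\<^sub>m (2 ^ n)" using mat_inverse(2)[OF D *] by auto
qed

end

theory Submission
  imports Defs
begin

text \<open>
  Write \<open>k = (k\<^sub>1; k\<^sub>2)\<close>, \<open>x = A\<^sub>n k\<^sub>1\<close> and \<open>y = D\<^sub>n A\<^sub>n k\<^sub>2\<close>.  The block form of \<open>A\<^sub>n\<^sub>+\<^sub>1\<close> gives
  \<open>A\<^sub>n\<^sub>+\<^sub>1 k = (x + y; x - y)\<close>, so membership of \<open>k\<close> in the larger polytope says, in every coordinate,
  \<open>b\<^sub>1 \<le> x + y \<le> c\<^sub>1\<close> and \<open>b\<^sub>2 \<le> x - y \<le> c\<^sub>2\<close>.  Solved for \<open>y\<close>, these four inequalities are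
  \<open>max (b\<^sub>1 - x) (x - c\<^sub>2) \<le> y \<le> min (c\<^sub>1 - x) (x - b\<^sub>2)\<close>, and adding them in pairs yields the bound
  \<open>\<rho>\<^sub>n b \<le> x \<le> \<rho>\<^sub>n c\<close> (lemma \<open>sum_diff_bounds_iff\<close>).  The latter does not involve \<open>y\<close>, so it confines
  \<open>k\<^sub>1\<close> to a polytope of half the dimension before \<open>k\<^sub>2\<close> is chosen.

  It remains to pass from bounds on \<open>y = D\<^sub>n (A\<^sub>n k\<^sub>2)\<close> to bounds on \<open>A\<^sub>n k\<^sub>2\<close>.  As \<open>D\<^sub>n\<close> is diagonal
  with positive entries, multiplication by \<open>D\<^sub>n\<close> or its inverse preserves and reflects the
  componentwise order, and \<open>D\<^sub>n\<close> can be moved across an inequality (lemmas \<open>D_inv_mult_vec_le_iff\<close>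
  and \<open>le_D_inv_mult_vec_iff\<close>).  Integrality is a condition on the entries of \<open>k\<close>, hence
  splits over the two halves.
\<close>

lemma D_mat_carrier [simp]: "D_mat n \<in> carrier_mat (2 ^ n) (2 ^ n)"
  by (simp add: D_mat_def)

lemma A_mat_carrier [simp]: "A_mat n \<in> carrier_mat (2 ^ n) (2 ^ n)"
proof (induction n)
  case (Suc n)
  have "- D_mat n * A_mat n \<in> carrier_mat (2 ^ n) (2 ^ n)"
    using Suc by (intro mult_carrier_mat[of _ _ "2 ^ n"]) auto
  then show ?case
    using four_block_carrier_mat[OF Suc, of _ "2 ^ n" "2 ^ n"] by (simp add: mult_2)
qed simp

lemma index_D_mat_mult_vec:
  assumes "w \<in> carrier_vec (2 ^ n)" "i < 2 ^ n"
  shows "(D_mat n *\<^sub>v w) $ i = xi (n + 1) (i + 1) * w $ i"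
proof -
  have "(D_mat n *\<^sub>v w) $ i = (\<Sum>j = 0..<2 ^ n. (if i = j then xi (n + 1) (j + 1) else 0) * w $ j)"
    using assms by (auto simp: D_mat_def mat_diag_def scalar_prod_def intro!: sum.cong)
  also have "\<dots> = (\<Sum>j = 0..<2 ^ n. if j = i then xi (n + 1) (i + 1) * w $ i else 0)"
    by (intro sum.cong) auto
  also have "\<dots> = xi (n + 1) (i + 1) * w $ i"
    using assms by simp
  finally show ?thesis .
qed

lemma D_mat_mult_vec_le_iff:
  assumes "u \<in> carrier_vec (2 ^ n)" "w \<in> carrier_vec (2 ^ n)"
  shows "D_mat n *\<^sub>v u \<le> D_mat n *\<^sub>v w \<longleftrightarrow> u \<le> w"
proof -
  have "(D_mat n *\<^sub>v u) $ i \<le> (D_mat n *\<^sub>v w) $ i \<longleftrightarrow> u $ i \<le> w $ i" if "i < 2 ^ n" for i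
    using that xi_pos[OF that] unfolding index_D_mat_mult_vec[OF assms(1) that]
      index_D_mat_mult_vec[OF assms(2) that] by simp
  moreover have "dim_row (D_mat n) = 2 ^ n" by (rule carrier_matD(1)[OF D_mat_carrier])
  ultimately show ?thesis
    using assms by (auto simp: less_eq_vec_def)
qed

lemma D_mat_D_inv_mult_vec:
  assumes "u \<in> carrier_vec (2 ^ n)"
  shows "D_mat n *\<^sub>v (D_inv n *\<^sub>v u) = u"
  using assoc_mult_mat_vec[OF D_mat_carrier D_inv(2) assms] assms by (simp add: D_inv(3))

lemma D_inv_mult_vec_le_iff:
  assumes "u \<in> carrier_vec (2 ^ n)" "w \<in> carrier_vec (2 ^ n)"
  shows "D_inv n *\<^sub>v u \<le> w \<longleftrightarrow> u \<le> D_mat n *\<^sub>v w"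
  using D_mat_mult_vec_le_iff[of "D_inv n *\<^sub>v u" n w] assms D_inv(2)[of n]
  by (simp add: D_mat_D_inv_mult_vec)

lemma le_D_inv_mult_vec_iff:
  assumes "u \<in> carrier_vec (2 ^ n)" "w \<in> carrier_vec (2 ^ n)"
  shows "w \<le> D_inv n *\<^sub>v u \<longleftrightarrow> D_mat n *\<^sub>v w \<le> u"
  using D_mat_mult_vec_le_iff[of w n "D_inv n *\<^sub>v u"] assms D_inv(2)[of n]
  by (simp add: D_mat_D_inv_mult_vec)

lemma A_mat_Suc_mult_append:
  assumes "k1 \<in> carrier_vec (2 ^ n)" "k2 \<in> carrier_vec (2 ^ n)"
  defines "x \<equiv> A_mat n *\<^sub>v k1" and "y \<equiv> D_mat n *\<^sub>v (A_mat n *\<^sub>v k2)"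
  shows "A_mat (Suc n) *\<^sub>v (k1 @\<^sub>v k2) = (x + y) @\<^sub>v (x - y)"
proof -
  have DA: "D_mat n * A_mat n \<in> carrier_mat (2 ^ n) (2 ^ n)"
    by (rule mult_carrier_mat[OF D_mat_carrier A_mat_carrier])
  have mDA: "- D_mat n * A_mat n \<in> carrier_mat (2 ^ n) (2 ^ n)"
    by (rule mult_carrier_mat[of _ _ "2 ^ n"]) simp_all
  have y: "(D_mat n * A_mat n) *\<^sub>v k2 = y"
    unfolding y_def by (rule assoc_mult_mat_vec[OF D_mat_carrier A_mat_carrier assms(2)])
  have neg: "- D_mat n * A_mat n = - (D_mat n * A_mat n)"
    by (rule uminus_mult_left_mat)
      (simp add: carrier_matD[OF D_mat_carrier] carrier_matD[OF A_mat_carrier])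
  have my: "(- D_mat n * A_mat n) *\<^sub>v k2 = - y"
    unfolding y[symmetric] neg
    by (rule uminus_mult_mat_vec) (simp only: carrier_matD[OF DA] carrier_vecD[OF assms(2)])
  have "x \<in> carrier_vec (2 ^ n)" "y \<in> carrier_vec (2 ^ n)"
    unfolding x_def y_def
    by (intro mult_mat_vec_carrier[OF A_mat_carrier] mult_mat_vec_carrier[OF D_mat_carrier] assms(1,2))+
  then have diff: "x + - y = x - y"
    by (intro eq_vecI) auto
  show ?thesis
    using four_block_mat_mult_vec[OF A_mat_carrier DA A_mat_carrier mDA assms(1,2)]
    unfolding y my x_def[symmetric] A_mat.simps(2) diff .
qed

text \<open>
  This is Fourier-Motzkin elimination of \<open>y\<close>.  A lower and an upper bound on \<open>y\<close> that come one from
  the sum and one from the difference combine to a bound on \<open>x\<close>; the first line of the right-hand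
  side collects these, and hence follows from the second.
\<close>

lemma sum_diff_bounds_iff:
  fixes x y b1 b2 c1 c2 :: real
  shows "b1 \<le> x + y \<and> b2 \<le> x - y \<and> x + y \<le> c1 \<and> x - y \<le> c2 \<longleftrightarrow>
    (1 / 2 * (b1 + b2) \<le> x \<and> x \<le> 1 / 2 * (c1 + c2)) \<and>
    max (b1 - x) (- c2 + x) \<le> y \<and> y \<le> min (c1 - x) (- b2 + x)"
  by (auto simp: field_simps)

lemma vec_sum_diff_bounds_iff:
  assumes x: "x \<in> carrier_vec (2 ^ n)" and y: "y \<in> carrier_vec (2 ^ n)"
    and b: "b \<in> carrier_vec (2 ^ n + 2 ^ n)" and c: "c \<in> carrier_vec (2 ^ n + 2 ^ n)"
  shows "b \<le> (x + y) @\<^sub>v (x - y) \<and> (x + y) @\<^sub>v (x - y) \<le> c \<longleftrightarrow>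
    (rho n b \<le> x \<and> x \<le> rho n c) \<and>
    vec_max (vec_first b (2 ^ n) - x) (- vec_last c (2 ^ n) + x) \<le> y \<and>
    y \<le> vec_min (vec_first c (2 ^ n) - x) (- vec_last b (2 ^ n) + x)"
proof -
  define b1 b2 c1 c2 where "b1 = vec_first b (2 ^ n)" "b2 = vec_last b (2 ^ n)"
    "c1 = vec_first c (2 ^ n)" "c2 = vec_last c (2 ^ n)"
  note halves = this
  have car: "b1 \<in> carrier_vec (2 ^ n)" "b2 \<in> carrier_vec (2 ^ n)"
    "c1 \<in> carrier_vec (2 ^ n)" "c2 \<in> carrier_vec (2 ^ n)"
    by (simp_all add: halves)
  have "b = b1 @\<^sub>v b2" "c = c1 @\<^sub>v c2"
    using b c by (simp_all add: halves)
  then have "b \<le> (x + y) @\<^sub>v (x - y) \<and> (x + y) @\<^sub>v (x - y) \<le> c \<longleftrightarrow>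
    b1 \<le> x + y \<and> b2 \<le> x - y \<and> x + y \<le> c1 \<and> x - y \<le> c2"
    using append_vec_le[OF car(1) add_carrier_vec[OF x y]]
      append_vec_le[OF add_carrier_vec[OF x y] car(3)] by simp
  also have "\<dots> \<longleftrightarrow> (\<forall>i < 2 ^ n. b1 $ i \<le> x $ i + y $ i \<and> b2 $ i \<le> x $ i - y $ i \<and>
      x $ i + y $ i \<le> c1 $ i \<and> x $ i - y $ i \<le> c2 $ i)"
    using x y car by (auto simp: less_eq_vec_def)
  also have "\<dots> \<longleftrightarrow> (\<forall>i < 2 ^ n.
      (1 / 2 * (b1 $ i + b2 $ i) \<le> x $ i \<and> x $ i \<le> 1 / 2 * (c1 $ i + c2 $ i)) \<and>
      max (b1 $ i - x $ i) (- c2 $ i + x $ i) \<le> y $ i \<and>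
      y $ i \<le> min (c1 $ i - x $ i) (- b2 $ i + x $ i))"
    unfolding sum_diff_bounds_iff ..
  also have "\<dots> \<longleftrightarrow> (rho n b \<le> x \<and> x \<le> rho n c) \<and>
    vec_max (b1 - x) (- c2 + x) \<le> y \<and> y \<le> vec_min (c1 - x) (- b2 + x)"
    using x y car unfolding rho_def halves[symmetric]
    by (auto simp: less_eq_vec_def vec_max_def vec_min_def)
  finally show ?thesis unfolding halves .
qed

lemma A_mat_Suc_mult_append_bounds_iff:
  assumes k: "k1 \<in> carrier_vec (2 ^ n)" "k2 \<in> carrier_vec (2 ^ n)"
    and b: "b \<in> carrier_vec (2 ^ n + 2 ^ n)" and c: "c \<in> carrier_vec (2 ^ n + 2 ^ n)"
  defines "x \<equiv> A_mat n *\<^sub>v k1" and "z \<equiv> A_mat n *\<^sub>v k2"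
  shows "b \<le> A_mat (Suc n) *\<^sub>v (k1 @\<^sub>v k2) \<and> A_mat (Suc n) *\<^sub>v (k1 @\<^sub>v k2) \<le> c \<longleftrightarrow>
    (rho n b \<le> x \<and> x \<le> rho n c) \<and> phi n x b c \<le> z \<and> z \<le> psi n x b c"
proof -
  have x: "x \<in> carrier_vec (2 ^ n)" and z: "z \<in> carrier_vec (2 ^ n)"
    unfolding x_def z_def using k by (auto intro!: mult_mat_vec_carrier)
  have Dz: "D_mat n *\<^sub>v z \<in> carrier_vec (2 ^ n)"
    using z by (auto intro!: mult_mat_vec_carrier)
  have "vec_max (vec_first b (2 ^ n) - x) (- vec_last c (2 ^ n) + x) \<in> carrier_vec (2 ^ n)"
    "vec_min (vec_first c (2 ^ n) - x) (- vec_last b (2 ^ n) + x) \<in> carrier_vec (2 ^ n)"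
    using carrier_vecD[OF x] by (auto intro!: carrier_vecI simp: vec_max_def vec_min_def)
  then have "phi n x b c \<le> z \<and> z \<le> psi n x b c \<longleftrightarrow>
    vec_max (vec_first b (2 ^ n) - x) (- vec_last c (2 ^ n) + x) \<le> D_mat n *\<^sub>v z \<and>
    D_mat n *\<^sub>v z \<le> vec_min (vec_first c (2 ^ n) - x) (- vec_last b (2 ^ n) + x)"
    unfolding phi_def psi_def
    using D_inv_mult_vec_le_iff[OF _ z] le_D_inv_mult_vec_iff[OF _ z] by blast
  then show ?thesis
    using vec_sum_diff_bounds_iff[OF x Dz b c]
    unfolding A_mat_Suc_mult_append[OF k] x_def[symmetric] z_def[symmetric] by blast
qed

lemma append_vec_entries_iff:
  assumes "u \<in> carrier_vec d" "v \<in> carrier_vec e"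
  shows "(\<forall>i < d + e. P ((u @\<^sub>v v) $ i)) \<longleftrightarrow> (\<forall>i < d. P (u $ i)) \<and> (\<forall>i < e. P (v $ i))"
proof (intro iffI conjI allI impI)
  assume *: "\<forall>i < d + e. P ((u @\<^sub>v v) $ i)"
  show "P (u $ i)" if "i < d" for i
    using *[rule_format, of i] that assms by simp
  show "P (v $ i)" if "i < e" for i
    using *[rule_format, of "d + i"] that assms by simp
qed (use assms in auto)

lemma append_mem_P_set_Suc_iff:
  assumes k: "k1 \<in> carrier_vec (2 ^ n)" "k2 \<in> carrier_vec (2 ^ n)"
    and b: "b \<in> carrier_vec (2 ^ n + 2 ^ n)" and c: "c \<in> carrier_vec (2 ^ n + 2 ^ n)"
  shows "k1 @\<^sub>v k2 \<in> P_set (Suc n) b c \<longleftrightarrow>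
    k1 \<in> P_set n (rho n b) (rho n c) \<and>
    k2 \<in> P_set n (phi n (A_mat n *\<^sub>v k1) b c) (psi n (A_mat n *\<^sub>v k1) b c)"
proof -
  have d: "2 ^ Suc n = 2 ^ n + (2 ^ n :: nat)" by simp
  have "k1 @\<^sub>v k2 \<in> P_set (Suc n) b c \<longleftrightarrow>
    ((\<forall>i < 2 ^ n. k1 $ i \<in> \<int>) \<and> (\<forall>i < 2 ^ n. k2 $ i \<in> \<int>)) \<and>
    (b \<le> A_mat (Suc n) *\<^sub>v (k1 @\<^sub>v k2) \<and> A_mat (Suc n) *\<^sub>v (k1 @\<^sub>v k2) \<le> c)"
    unfolding P_set_def d mem_Collect_eq
      append_vec_entries_iff[OF k, of "\<lambda>z. z \<in> \<int>"]
    using append_carrier_vec[OF k] by blast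
  then show ?thesis
    unfolding A_mat_Suc_mult_append_bounds_iff[OF k b c] P_set_def using k by blast
qed

theorem theorem3p5:
  fixes n d :: nat and b c :: "real vec"
  assumes "d = 2 ^ n"
    and "b \<in> carrier_vec (2 * d)" and "c \<in> carrier_vec (2 * d)"
  shows "P_set (n + 1) b c =
    {k1 @\<^sub>v k2 | k1 k2.
       k1 \<in> carrier_vec d \<and> k2 \<in> carrier_vec d \<and>
       k1 \<in> P_set n (rho n b) (rho n c) \<and>
       k2 \<in> P_set n (phi n (A_mat n *\<^sub>v k1) b c) (psi n (A_mat n *\<^sub>v k1) b c)}"
    (is "_ = ?R")
proof (rule Set.set_eqI)
  fix k
  have b: "b \<in> carrier_vec (2 ^ n + 2 ^ n)" and c: "c \<in> carrier_vec (2 ^ n + 2 ^ n)"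
    using assms by (simp_all add: mult_2)
  note append_iff = append_mem_P_set_Suc_iff[OF _ _ b c]
  show "k \<in> P_set (n + 1) b c \<longleftrightarrow> k \<in> ?R"
  proof
    assume k: "k \<in> P_set (n + 1) b c"
    then have "k \<in> carrier_vec (d + d)"
      by (simp add: P_set_def assms(1) mult_2)
    then have "k = vec_first k d @\<^sub>v vec_last k d"
      by simp
    then show "k \<in> ?R"
      using k append_iff[of "vec_first k d" "vec_last k d"] assms(1)
      by (metis (mono_tags, lifting) Suc_eq_plus1 mem_Collect_eq vec_first_carrier vec_last_carrier)
  next
    assume "k \<in> ?R"
    then show "k \<in> P_set (n + 1) b c"
      using append_iff assms(1) by auto
  qed
qed

end
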